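(* Consider a tiered auction instance (supplies $q_1,\dots,q_L$, bidders $1,\dots,n$ with tiers $\ell(i)$ and marginal valuations $u_i(j)$). If all bidders bid sincerely, then in the tiered clinching auction each bidder is charged its externality (VCG payment). That is, if $(x_1,\dots,x_n)$ is the allocation computed by the auction, then for every bidder $i$ the sum of the prices paid by $i$ for the items it clinches equals $$\max_{y}\ \sum_{j\ne i}\sum_{k=1}^{y_j}u_j(k)\;-\;\sum_{j\ne i}\sum_{k=1}^{x_j}u_j(k),$$ where the maximum is over all feasible allocations $y=(y_1,\dots,y_n)$ with $y_i=0$.
   Context: **Tiered instance.** There are tiers $1,\dots,L$ of items ($1$ lowest quality, $L$ highest). Tier $k$ contains $q_k$ identical items ($q_k$ a nonnegative integer), and $q=\sum_{k=1}^L q_k$. There are $n$ bidders. Bidder $i$ has a tier $\ell(i)\in\{1,\dots,L\}$, the lowest quality it accepts; it accepts items of any tier $\ge\ell(i)$ and is otherwise indifferent to quality. It has marginal valuations $u_i(1)\ge u_i(2)\ge\dots\ge u_i(q)\ge 0$, where $u_i(j)$ is the value of its $j$-th acceptable item. Standing assumptions: the valuations are integers; the positive marginal valuations (over all pairs $(i,j)$) are pairwise distinct; and no submarket is initially undersubscribed, i.e. for every $t\in\{1,\dots,L\}$, $\#\{(i,j): \ell(i)\le t,\ u_i(j)>0\}\ \ge\ \sum_{k=1}^t q_k$. **Feasible allocation.** A vector $(x_1,\dots,x_n)$ of nonnegative integers with $\sum_{i:\ell(i)\ge t}x_i\le\sum_{k=t}^L q_k$ for all $t\in\{1,\dots,L\}$.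 **Tiered clinching auction under sincere bidding.** State: a price $p$ (initially $0$), remaining supplies $r_k$ (initially $r_k=q_k$), and the number $C_i$ of items clinched so far by bidder $i$ (initially $0$). Sincere demand of bidder $i$ at price $p$ is $D_i(p)=\#\{j: u_i(j)>p\}$, and its residual demand is $R_i(p)=\max\{D_i(p)-C_i,0\}$. Submarket $\mathcal M_t$ consists of the items of tiers $\le t$ and the bidders of tiers $\le t$. Repeat the following: (1) Search for a pair $(t,i)$ with $\ell(i)\le t$ and $\sum_{j\ne i,\ \ell(j)\le t}R_j(p)<\sum_{k=1}^t r_k$, going through $t=1,\dots,L$ in increasing order and, for each $t$, through $i=1,\dots,n$ in increasing order. (2) If such a pair exists, take the first one: bidder $i$ clinches an item in submarket $\mathcal M_t$. It is given an item of the lowest tier $s\ge\ell(i)$ with $r_s>0$ and pays $p$ for it; set $r_s\leftarrow r_s-1$, $C_i\leftarrow C_i+1$, and repeat from (1) at the same price. (3) If no such pair exists: if $r_1=\dots=r_L=0$, terminate; otherwise set $p\leftarrow p+1$ and repeat from (1). The computed allocation is $x_i=$ the final value of $C_i$. *)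

theory Defs
  imports Main
begin

text \<open>Tiers are indexed by \<open>{1..L}\<close>, bidders by \<open>{1..n}\<close> and marginal valuations by
  \<open>{1..q}\<close>; the functions below are irrelevant outside these ranges.\<close>

record instance_data =
  num_tiers :: nat
  tier_supply :: "nat \<Rightarrow> nat"
  num_bidders :: nat
  tier :: "nat \<Rightarrow> nat"
  valuation :: "nat \<Rightarrow> nat \<Rightarrow> int"

definition total_supply :: "instance_data \<Rightarrow> nat" where
  "total_supply I = (\<Sum>k = 1..num_tiers I. tier_supply I k)"

definition tiered_instance :: "instance_data \<Rightarrow> bool" where
  "tiered_instance I \<longleftrightarrow>
     (\<forall>i\<in>{1..num_bidders I}. tier I i \<in> {1..num_tiers I}) \<and>
     (\<forall>i\<in>{1..num_bidders I}. \<forall>j\<in>{1..total_supply I}. 0 \<le> valuation I i j) \<and>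
     (\<forall>i\<in>{1..num_bidders I}. \<forall>j\<in>{1..total_supply I}. \<forall>j'\<in>{1..total_supply I}.
        j \<le> j' \<longrightarrow> valuation I i j' \<le> valuation I i j)"

definition distinct_valuations :: "instance_data \<Rightarrow> bool" where
  "distinct_valuations I \<longleftrightarrow>
     inj_on (\<lambda>(i, j). valuation I i j)
       {(i, j). i \<in> {1..num_bidders I} \<and> j \<in> {1..total_supply I} \<and> 0 < valuation I i j}"

definition not_undersubscribed :: "instance_data \<Rightarrow> bool" where
  "not_undersubscribed I \<longleftrightarrow>
     (\<forall>t\<in>{1..num_tiers I}.
        (\<Sum>k = 1..t. tier_supply I k) \<le>
        card {(i, j). i \<in> {1..num_bidders I} \<and> j \<in> {1..total_supply I} \<and>
                      tier I i \<le> t \<and> 0 < valuation I i j})"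

definition feasible :: "instance_data \<Rightarrow> (nat \<Rightarrow> nat) \<Rightarrow> bool" where
  "feasible I x \<longleftrightarrow>
     (\<forall>t\<in>{1..num_tiers I}.
        (\<Sum>i | i \<in> {1..num_bidders I} \<and> t \<le> tier I i. x i) \<le> (\<Sum>k = t..num_tiers I. tier_supply I k))"

definition others_value :: "instance_data \<Rightarrow> nat \<Rightarrow> (nat \<Rightarrow> nat) \<Rightarrow> int" where
  "others_value I i x = (\<Sum>j\<in>{1..num_bidders I} - {i}. \<Sum>k = 1..x j. valuation I j k)"

definition externality :: "instance_data \<Rightarrow> (nat \<Rightarrow> nat) \<Rightarrow> nat \<Rightarrow> int" where
  "externality I x i =
     Max {others_value I i y | y. feasible I y \<and> y i = 0} - others_value I i x"

text \<open>The maximum is over a finite nonempty set, so that \<open>Max\<close> is meaningful.\<close>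

lemma finite_others_values:
  assumes "tiered_instance I"
  shows "finite {others_value I i y | y. feasible I y \<and> y i = 0}"
proof -
  let ?n = "num_bidders I" and ?q = "total_supply I"
  have "finite {y. \<forall>a. (a \<in> {1..?n} \<longrightarrow> y a \<in> {..?q}) \<and> (a \<notin> {1..?n} \<longrightarrow> y a = 0)}"
    by (rule finite_set_of_finite_funs) auto
  moreover have "{others_value I i y | y. feasible I y \<and> y i = 0} \<subseteq>
    others_value I i ` {y. \<forall>a. (a \<in> {1..?n} \<longrightarrow> y a \<in> {..?q}) \<and> (a \<notin> {1..?n} \<longrightarrow> y a = 0)}"
  proof clarify
    fix y assume y: "feasible I y"
    let ?z = "\<lambda>a. if a \<in> {1..?n} then y a else 0"
    have "y a \<le> ?q" if a: "a \<in> {1..?n}" for a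
    proof -
      have t: "tier I j \<in> {1..num_tiers I}" if "j \<in> {1..?n}" for j
        using assms that unfolding tiered_instance_def by blast
      then have one: "1 \<in> {1..num_tiers I}" using a by fastforce
      have "{j. j \<in> {1..?n} \<and> 1 \<le> tier I j} = {1..?n}" using t by auto
      then have "(\<Sum>j = 1..?n. y j) \<le> ?q"
        using bspec[OF y[unfolded feasible_def] one] by (simp add: total_supply_def)
      then show ?thesis using member_le_sum[of a "{1..?n}" y] a by simp
    qed
    moreover have "others_value I i y = others_value I i ?z"
      unfolding others_value_def by (rule sum.cong) auto
    ultimately show "others_value I i y \<in> others_value I i `
      {y. \<forall>a. (a \<in> {1..?n} \<longrightarrow> y a \<in> {..?q}) \<and> (a \<notin> {1..?n} \<longrightarrow> y a = 0)}"
      by (intro image_eqI[of _ _ ?z]) auto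
  qed
  ultimately show ?thesis by (meson finite_imageI finite_subset)
qed

lemma nonempty_others_values: "{others_value I i y | y. feasible I y \<and> y i = 0} \<noteq> {}"
proof -
  have "feasible I (\<lambda>_. 0)" by (simp add: feasible_def)
  then show ?thesis by blast
qed

text \<open>\<open>paid S i\<close> accumulates the prices of all items clinched so far by bidder \<open>i\<close>.\<close>

record auction_state =
  price :: int
  remaining :: "nat \<Rightarrow> nat"
  clinched :: "nat \<Rightarrow> nat"
  paid :: "nat \<Rightarrow> int"

definition initial_state :: "instance_data \<Rightarrow> auction_state" where
  "initial_state I =
     \<lparr>price = 0, remaining = tier_supply I, clinched = (\<lambda>_. 0), paid = (\<lambda>_. 0)\<rparr>"

definition demand :: "instance_data \<Rightarrow> nat \<Rightarrow> int \<Rightarrow> nat" where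
  "demand I i p = card {j \<in> {1..total_supply I}. p < valuation I i j}"

text \<open>The maximum of 0 and the difference is exactly truncated subtraction on naturals.\<close>

definition residual_demand :: "instance_data \<Rightarrow> auction_state \<Rightarrow> nat \<Rightarrow> nat" where
  "residual_demand I S i = demand I i (price S) - clinched S i"

definition can_clinch :: "instance_data \<Rightarrow> auction_state \<Rightarrow> nat \<Rightarrow> nat \<Rightarrow> bool" where
  "can_clinch I S t i \<longleftrightarrow>
     t \<in> {1..num_tiers I} \<and> i \<in> {1..num_bidders I} \<and> tier I i \<le> t \<and>
     (\<Sum>j | j \<in> {1..num_bidders I} \<and> j \<noteq> i \<and> tier I j \<le> t. residual_demand I S j)
       < (\<Sum>k = 1..t. remaining S k)"

definition first_clinch :: "instance_data \<Rightarrow> auction_state \<Rightarrow> nat \<Rightarrow> nat \<Rightarrow> bool" where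
  "first_clinch I S t i \<longleftrightarrow>
     can_clinch I S t i \<and>
     (\<forall>t' i'. can_clinch I S t' i' \<longrightarrow> t < t' \<or> t = t' \<and> i \<le> i')"

definition lowest_available :: "instance_data \<Rightarrow> auction_state \<Rightarrow> nat \<Rightarrow> nat \<Rightarrow> bool" where
  "lowest_available I S i s \<longleftrightarrow>
     s \<in> {tier I i..num_tiers I} \<and> 0 < remaining S s \<and>
     (\<forall>k\<in>{tier I i..<s}. remaining S k = 0)"

definition assign_item :: "nat \<Rightarrow> nat \<Rightarrow> auction_state \<Rightarrow> auction_state" where
  "assign_item i s S =
     S\<lparr>remaining := (remaining S)(s := remaining S s - 1),
       clinched := (clinched S)(i := clinched S i + 1),
       paid := (paid S)(i := paid S i + price S)\<rparr>"

definition sold_out :: "instance_data \<Rightarrow> auction_state \<Rightarrow> bool" where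
  "sold_out I S \<longleftrightarrow> (\<forall>k\<in>{1..num_tiers I}. remaining S k = 0)"

inductive auction_step :: "instance_data \<Rightarrow> auction_state \<Rightarrow> auction_state \<Rightarrow> bool" for I where
  clinch: "first_clinch I S t i \<Longrightarrow> lowest_available I S i s \<Longrightarrow>
    auction_step I S (assign_item i s S)"
| raise_price: "(\<And>t i. \<not> can_clinch I S t i) \<Longrightarrow> \<not> sold_out I S \<Longrightarrow>
    auction_step I S (S\<lparr>price := price S + 1\<rparr>)"

text \<open>The run starting in the initial state reaches \<open>S\<close> and terminates there.\<close>

definition auction_result :: "instance_data \<Rightarrow> auction_state \<Rightarrow> bool" where
  "auction_result I S \<longleftrightarrow>
     (auction_step I)\<^sup>*\<^sup>* (initial_state I) S \<and>
     (\<forall>t i. \<not> can_clinch I S t i) \<and> sold_out I S"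

end

theory Submission
  imports Defs
begin

text \<open>For a fixed bidder \<open>i\<close>, consider the largest value that the bidders other than \<open>i\<close> can reach
  when they keep what they have clinched and share the remaining supply among themselves. It does
  not change when the price rises or when another bidder clinches an item, and it drops by exactly
  the current price when \<open>i\<close> clinches an item. Initially it is the maximum in the externality, and
  at the end it is the value of the others in the computed allocation. The exchange arguments behind
  this rest on two invariants: the residual demand of every submarket covers its remaining supply,
  and, once the price \<open>p\<close> is positive, so does the residual demand at price \<open>p - 1\<close> without any
  single bidder.\<close>

section \<open>Sums under a change of one entry\<close>

lemma sum_fun_upd_Suc:
  fixes f :: "'a \<Rightarrow> nat"
  assumes "finite A"
  shows "sum (f(j := Suc (f j))) A = sum f A + (if j \<in> A then 1 else 0)"
proof (cases "j \<in> A")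
  case True
  have "sum (f(j := Suc (f j))) (A - {j}) = sum f (A - {j})" by (rule sum.cong) auto
  then show ?thesis using True assms by (simp add: sum.remove[of A j])
next
  case False
  then have "sum (f(j := Suc (f j))) A = sum f A" by (intro sum.cong) auto
  then show ?thesis using False by simp
qed

lemma sum_fun_upd_pred:
  fixes f :: "'a \<Rightarrow> nat"
  assumes "finite A" "0 < f j"
  shows "sum f A = sum (f(j := f j - 1)) A + (if j \<in> A then 1 else 0)"
  using sum_fun_upd_Suc[OF assms(1), of "f(j := f j - 1)" j] assms(2) by simp

lemma sum_partition:
  assumes "finite A" "A = B \<union> D" "B \<inter> D = {}"
  shows "sum f A = sum f B + sum f D"
  using assms by (simp add: sum.union_disjoint)

section \<open>Residual demand of the submarkets\<close>

text \<open>Holdings, price and excluded bidders are separate arguments: \<open>X = {i}\<close>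
  gives the clinching test for \<open>i\<close>, \<open>X = {}\<close> the demand of the whole
  submarket, and the price may also be the one before the current one.\<close>

definition competing_demand :: "instance_data \<Rightarrow> (nat \<Rightarrow> nat) \<Rightarrow> int \<Rightarrow> nat set \<Rightarrow> nat \<Rightarrow> nat" where
  "competing_demand I C p X t =
     (\<Sum>j\<in>{j \<in> {1..num_bidders I}. tier I j \<le> t} - X. demand I j p - C j)"

lemma can_clinch_iff:
  "can_clinch I S t i \<longleftrightarrow>
     t \<in> {1..num_tiers I} \<and> i \<in> {1..num_bidders I} \<and> tier I i \<le> t \<and>
     competing_demand I (clinched S) (price S) {i} t < (\<Sum>k = 1..t. remaining S k)"
proof -
  have "{j. j \<in> {1..num_bidders I} \<and> j \<noteq> i \<and> tier I j \<le> t}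
      = {j \<in> {1..num_bidders I}. tier I j \<le> t} - {i}" by auto
  then show ?thesis
    unfolding can_clinch_def competing_demand_def residual_demand_def by simp
qed

text \<open>Exclusions on the right matter only for bidders of submarket \<open>t\<close>, so
  excluding a bidder of a tier above \<open>t\<close> costs nothing.\<close>

lemma competing_demand_mono:
  assumes "t \<le> t'" "\<And>j. j \<in> X' \<Longrightarrow> j \<in> {1..num_bidders I} \<Longrightarrow> tier I j \<le> t \<Longrightarrow> j \<in> X"
  shows "competing_demand I C p X t \<le> competing_demand I C p X' t'"
  unfolding competing_demand_def using assms by (intro sum_mono2) auto

text \<open>Marginal values are nonincreasing, so the units worth more than \<open>p\<close> form an
  initial segment whose length is the demand.\<close>

lemma demand_iff:
  assumes "tiered_instance I" "i \<in> {1..num_bidders I}" "k \<in> {1..total_supply I}"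
  shows "p < valuation I i k \<longleftrightarrow> k \<le> demand I i p"
proof
  have mono: "valuation I i j' \<le> valuation I i j"
    if "j \<in> {1..total_supply I}" "j' \<in> {1..total_supply I}" "j \<le> j'" for j j'
    using assms(1,2) that unfolding tiered_instance_def by blast
  {
    assume p: "p < valuation I i k"
    have "{1..k} \<subseteq> {j \<in> {1..total_supply I}. p < valuation I i j}"
    proof
      fix j assume j: "j \<in> {1..k}"
      then show "j \<in> {j \<in> {1..total_supply I}. p < valuation I i j}"
        using assms(3) p mono[of j k] by auto
    qed
    from card_mono[OF _ this] show "k \<le> demand I i p" by (simp add: demand_def)
  next
    assume k: "k \<le> demand I i p"
    show "p < valuation I i k"
    proof (rule ccontr)
      assume np: "\<not> p < valuation I i k"
      have "{j \<in> {1..total_supply I}. p < valuation I i j} \<subseteq> {1..k - 1}"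
      proof
        fix j assume j: "j \<in> {j \<in> {1..total_supply I}. p < valuation I i j}"
        then have "\<not> k \<le> j" using np mono[of k j] assms(3) by auto
        then show "j \<in> {1..k - 1}" using j by auto
      qed
      from card_mono[OF _ this] have "demand I i p \<le> k - 1" by (simp add: demand_def)
      then show False using k assms(3) by auto
    qed
  }
qed

text \<open>Values are integers, so demand changes from \<open>p\<close> to \<open>p + 1\<close>
  only for a bidder with a marginal value of exactly \<open>p + 1\<close>. That value is positive,
  so distinctness leaves at most one such bidder.\<close>

lemma demand_constant_except_one:
  assumes "distinct_valuations I" "0 \<le> p"
  obtains i where "\<And>j. j \<in> {1..num_bidders I} \<Longrightarrow> j \<noteq> i \<Longrightarrow> demand I j (p + 1) = demand I j p"
proof -
  define hits where
    "hits j \<longleftrightarrow> j \<in> {1..num_bidders I} \<and> (\<exists>k\<in>{1..total_supply I}. valuation I j k = p + 1)" for j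
  have "demand I j (p + 1) = demand I j p" if "j \<in> {1..num_bidders I}" "\<not> hits j" for j
  proof -
    have "p + 1 < valuation I j k \<longleftrightarrow> p < valuation I j k" if "k \<in> {1..total_supply I}" for k
      using that \<open>\<not> hits j\<close> \<open>j \<in> _\<close> unfolding hits_def by force
    then have "{k \<in> {1..total_supply I}. p + 1 < valuation I j k}
      = {k \<in> {1..total_supply I}. p < valuation I j k}" by blast
    then show ?thesis by (simp add: demand_def)
  qed
  moreover have "j = j'" if "hits j" "hits j'" for j j'
  proof -
    from that obtain k k' where k: "k \<in> {1..total_supply I}" "valuation I j k = p + 1"
        "k' \<in> {1..total_supply I}" "valuation I j' k' = p + 1"
      unfolding hits_def by blast
    have "(j, k) = (j', k')"
      by (rule inj_onD[OF assms(1)[unfolded distinct_valuations_def]])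
        (use that k assms(2) in \<open>auto simp: hits_def\<close>)
    then show ?thesis by simp
  qed
  ultimately show ?thesis by (metis that)
qed

section \<open>Coverage of supply by demand along the auction\<close>

text \<open>The empty submarket \<open>t = 0\<close> is included so that the tiers below a bidder's
  own tier always form an admissible submarket. The last clause keeps unit indices inside
  \<open>{1..total_supply I}\<close>, where the valuations are constrained.\<close>

definition market_invariant :: "instance_data \<Rightarrow> auction_state \<Rightarrow> bool" where
  "market_invariant I S \<longleftrightarrow>
     0 \<le> price S \<and>
     (\<forall>t\<le>num_tiers I. (\<Sum>k = 1..t. remaining S k)
        \<le> competing_demand I (clinched S) (price S) {} t) \<and>
     (0 < price S \<longrightarrow> (\<forall>i. \<forall>t\<le>num_tiers I. (\<Sum>k = 1..t. remaining S k)
        \<le> competing_demand I (clinched S) (price S - 1) {i} t)) \<and>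
     (\<Sum>j = 1..num_bidders I. clinched S j) + (\<Sum>k = 1..num_tiers I. remaining S k)
       = total_supply I"

text \<open>Grouped by bidder, the pairs of positive value number exactly the total demand at price
  \<open>0\<close>; the clause for the preceding price is vacuous.\<close>

lemma market_invariant_initial:
  assumes "tiered_instance I" "not_undersubscribed I"
  shows "market_invariant I (initial_state I)"
proof -
  have "(\<Sum>k = 1..t. tier_supply I k) \<le> competing_demand I (\<lambda>_. 0) 0 {} t"
    if "t \<le> num_tiers I" for t
  proof (cases "t = 0")
    case False
    let ?A = "{j \<in> {1..num_bidders I}. tier I j \<le> t}"
    have "{(i, j). i \<in> {1..num_bidders I} \<and> j \<in> {1..total_supply I} \<and>
                      tier I i \<le> t \<and> 0 < valuation I i j}
      = (SIGMA i:?A. {j \<in> {1..total_supply I}. 0 < valuation I i j})" by auto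
    moreover have "card (SIGMA i:?A. {j \<in> {1..total_supply I}. 0 < valuation I i j})
       = competing_demand I (\<lambda>_. 0) 0 {} t"
      unfolding competing_demand_def demand_def by (subst card_SigmaI) auto
    ultimately show ?thesis
      using assms(2)[unfolded not_undersubscribed_def, rule_format, of t] False that by simp
  qed simp
  then show ?thesis
    unfolding market_invariant_def initial_state_def by (simp add: total_supply_def)
qed

text \<open>Since nobody can clinch, every submarket is covered without any single bidder, which
  becomes the clause for the preceding price. At the new price only one bidder's demand may differ,
  and the others cover the supply without it.\<close>

lemma market_invariant_raise:
  assumes "distinct_valuations I" "market_invariant I S" "\<And>t i. \<not> can_clinch I S t i"
  shows "market_invariant I (S\<lparr>price := price S + 1\<rparr>)"
proof -
  let ?C = "clinched S" and ?p = "price S"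
  have p: "0 \<le> ?p" using assms(2) unfolding market_invariant_def by blast
  have single: "(\<Sum>k = 1..t. remaining S k) \<le> competing_demand I ?C ?p {i} t"
    if t: "t \<le> num_tiers I" for i t
  proof (cases "t \<noteq> 0 \<and> i \<in> {1..num_bidders I} \<and> tier I i \<le> t")
    case True
    then show ?thesis using assms(3)[of t i] t unfolding can_clinch_iff by auto
  next
    case False
    show ?thesis
    proof (cases "t = 0")
      case False
      then have "competing_demand I ?C ?p {} t \<le> competing_demand I ?C ?p {i} t"
        using \<open>\<not> (t \<noteq> 0 \<and> i \<in> _ \<and> tier I i \<le> t)\<close> by (intro competing_demand_mono) auto
      then show ?thesis using assms(2) t unfolding market_invariant_def by (meson le_trans)
    qed simp
  qed
  obtain i where i: "\<And>j. j \<in> {1..num_bidders I} \<Longrightarrow> j \<noteq> i \<Longrightarrow> demand I j (?p + 1) = demand I j ?p"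
    using demand_constant_except_one[OF assms(1) p] by blast
  have all: "(\<Sum>k = 1..t. remaining S k) \<le> competing_demand I ?C (?p + 1) {} t"
    if t: "t \<le> num_tiers I" for t
  proof -
    have "competing_demand I ?C ?p {i} t = competing_demand I ?C (?p + 1) {i} t"
      unfolding competing_demand_def by (rule sum.cong) (auto simp: i)
    also have "\<dots> \<le> competing_demand I ?C (?p + 1) {} t" by (rule competing_demand_mono) auto
    finally show ?thesis using single[OF t, of i] by simp
  qed
  show ?thesis
    using assms(2) single all p unfolding market_invariant_def by simp
qed

text \<open>Below the tier of \<open>j\<close> nothing changes. From there up to \<open>s\<close>
  the tiers are empty, so the bidders below already cover the supply. From \<open>s\<close> on,
  supply drops by one and residual demand by at most one. As \<open>p\<close> and \<open>X\<close>
  are arbitrary, both coverage clauses are served.\<close>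

lemma clinching_covers_supply:
  assumes "\<And>t. t \<le> num_tiers I \<Longrightarrow> (\<Sum>k = 1..t. r k) \<le> competing_demand I C p X t"
    and "1 \<le> tier I j" "tier I j \<le> s" "0 < r s" "\<forall>k\<in>{tier I j..<s}. r k = 0"
    and t: "t \<le> num_tiers I"
  shows "(\<Sum>k = 1..t. (r(s := r s - 1)) k) \<le> competing_demand I (C(j := C j + 1)) p X t"
proof -
  have sold: "sum r {1..t} = sum (r(s := r s - 1)) {1..t} + (if s \<in> {1..t} then 1 else 0)"
    using assms(4) by (intro sum_fun_upd_pred) auto
  have below: "competing_demand I C p X t' = competing_demand I (C(j := C j + 1)) p X t'"
    if "t' < tier I j" for t'
    unfolding competing_demand_def using that by (intro sum.cong) auto
  consider "t < tier I j" | "tier I j \<le> t" "t < s" | "s \<le> t" by linarith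
  then show ?thesis
  proof cases
    case 1
    then show ?thesis using sold assms(1)[OF t] below[of t] assms(3) by auto
  next
    case 2
    have "sum r {1..t} = sum r {1..tier I j - 1}"
      using 2 assms(2,5) by (intro sum.mono_neutral_right) auto
    also have "\<dots> \<le> competing_demand I C p X (tier I j - 1)" using assms(1) 2 t by auto
    also have "\<dots> = competing_demand I (C(j := C j + 1)) p X (tier I j - 1)"
      using assms(2) by (intro below) auto
    also have "\<dots> \<le> competing_demand I (C(j := C j + 1)) p X t"
      using 2 by (intro competing_demand_mono) auto
    finally show ?thesis using sold by auto
  next
    case 3
    let ?A = "{j' \<in> {1..num_bidders I}. tier I j' \<le> t} - X"
    have "competing_demand I C p X t
        \<le> (\<Sum>j'\<in>?A. (demand I j' p - (C(j := C j + 1)) j') + (if j' = j then 1 else 0))"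
      unfolding competing_demand_def by (rule sum_mono) auto
    also have "\<dots> \<le> competing_demand I (C(j := C j + 1)) p X t + 1"
      unfolding competing_demand_def sum.distrib by (simp add: sum.delta')
    finally show ?thesis using sold assms(1)[OF t] 3 assms(2,3) by auto
  qed
qed

section \<open>Allocations of the remaining supply\<close>

abbreviation bidders_from :: "instance_data \<Rightarrow> nat \<Rightarrow> nat set" where
  "bidders_from I t \<equiv> {j. j \<in> {1..num_bidders I} \<and> t \<le> tier I j}"

abbreviation feasible_for :: "instance_data \<Rightarrow> (nat \<Rightarrow> nat) \<Rightarrow> (nat \<Rightarrow> nat) \<Rightarrow> bool" where
  "feasible_for I r y \<equiv> feasible (I\<lparr>tier_supply := r\<rparr>) y"

lemma feasible_for_iff:
  "feasible_for I r y \<longleftrightarrow>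
     (\<forall>t\<in>{1..num_tiers I}. sum y (bidders_from I t) \<le> sum r {t..num_tiers I})"
  by (simp add: feasible_def)

lemma others_value_Suc:
  "others_value I i (z(j := Suc (z j))) =
     others_value I i z + (if j \<in> {1..num_bidders I} - {i} then valuation I j (Suc (z j)) else 0)"
proof -
  have "others_value I i (z(j := Suc (z j))) = (\<Sum>a\<in>{1..num_bidders I} - {i}.
      (\<Sum>k = 1..z a. valuation I a k) + (if a = j then valuation I j (Suc (z j)) else 0))"
    unfolding others_value_def by (rule sum.cong) auto
  then show ?thesis unfolding others_value_def by (simp add: sum.distrib)
qed

lemma others_value_add_Suc:
  "others_value I i (\<lambda>a. C a + (y(j := Suc (y j))) a) = others_value I i (\<lambda>a. C a + y a) +
     (if j \<in> {1..num_bidders I} - {i} then valuation I j (Suc (C j + y j)) else 0)"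
proof -
  have "(\<lambda>a. C a + (y(j := Suc (y j))) a) = (\<lambda>a. C a + y a)(j := Suc (C j + y j))" by auto
  then show ?thesis using others_value_Suc[of I i "\<lambda>a. C a + y a" j] by simp
qed

lemma others_value_add_pred:
  assumes "0 < y j"
  shows "others_value I i (\<lambda>a. C a + y a) = others_value I i (\<lambda>a. C a + (y(j := y j - 1)) a) +
     (if j \<in> {1..num_bidders I} - {i} then valuation I j (C j + y j) else 0)"
  using others_value_add_Suc[of I i C "y(j := y j - 1)" j] assms by simp

text \<open>Ensures that the units counted by \<open>C j + y j\<close> have indices to which
  \<open>demand_iff\<close> applies.\<close>

lemma feasible_within_total:
  assumes "tiered_instance I" "feasible_for I r y" "j \<in> {1..num_bidders I}"
    and "sum C {1..num_bidders I} + sum r {1..num_tiers I} = total_supply I"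
  shows "C j + y j \<le> total_supply I"
proof -
  have t: "tier I j \<in> {1..num_tiers I}" using assms(1,3) unfolding tiered_instance_def by blast
  have "y j \<le> sum y (bidders_from I (tier I j))" using assms(3) by (intro member_le_sum) auto
  also have "\<dots> \<le> sum r {tier I j..num_tiers I}" using assms(2) t unfolding feasible_for_iff by blast
  also have "\<dots> \<le> sum r {1..num_tiers I}" using t by (intro sum_mono2) auto
  finally have "y j \<le> sum r {1..num_tiers I}" .
  moreover have "C j \<le> sum C {1..num_bidders I}" using assms(3) by (intro member_le_sum) auto
  ultimately show ?thesis using assms(4) by linarith
qed

lemma exists_last_le:
  fixes t :: nat
  assumes "P t" "t \<le> s"
  shows "\<exists>t'. t' \<le> s \<and> P t' \<and> (\<forall>u. t' < u \<longrightarrow> u \<le> s \<longrightarrow> \<not> P u)"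
proof -
  let ?Q = "\<lambda>u. P u \<and> u \<le> s"
  have "?Q (Greatest ?Q)" by (rule GreatestI_nat[of ?Q t s]) (use assms in auto)
  moreover have "u \<le> Greatest ?Q" if "?Q u" for u by (rule Greatest_le_nat[of ?Q u s]) (use that in auto)
  ultimately show ?thesis by (meson leD)
qed

text \<open>A count over the tiers from \<open>t'\<close> to \<open>t\<close>: by tightness at
  \<open>t'\<close> and feasibility above \<open>t\<close>, their bidders get at least the supply of
  these tiers. By \<open>covers\<close> and \<open>scarce\<close>, the residual demand there without
  \<open>i\<close> is smaller than this supply.\<close>

lemma tight_exceeds_demand:
  assumes tiered: "tiered_instance I" and feasible: "feasible_for I r y"
    and tight: "sum y (bidders_from I t') = sum r {t'..num_tiers I}"
    and t': "1 \<le> t'" "t' \<le> t" "t \<le> num_tiers I"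
    and i: "y i = 0" and scarce: "competing_demand I C p {i} t < sum r {1..t}"
    and covers: "sum r {1..t' - 1} \<le> competing_demand I C p {i} (t' - 1)"
  obtains j where "j \<in> {1..num_bidders I}" "j \<noteq> i" "t' \<le> tier I j" "demand I j p - C j < y j"
proof -
  let ?mid = "{j \<in> {1..num_bidders I}. t' \<le> tier I j \<and> tier I j \<le> t}"
  have "\<exists>j\<in>?mid - {i}. demand I j p - C j < y j"
  proof (rule ccontr)
    assume "\<not> ?thesis"
    then have le: "y j \<le> demand I j p - C j" if "j \<in> ?mid - {i}" for j using that by (meson not_le)
    have "sum y (bidders_from I t') = sum y ?mid + sum y (bidders_from I (Suc t))"
      by (rule sum_partition) (use t' in auto)
    moreover have "sum y ?mid = sum y (?mid - {i})"
      using i by (intro sum.mono_neutral_right) auto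
    moreover have "sum y (?mid - {i}) \<le> (\<Sum>j\<in>?mid - {i}. demand I j p - C j)"
      using le by (rule sum_mono)
    moreover have "competing_demand I C p {i} t =
        competing_demand I C p {i} (t' - 1) + (\<Sum>j\<in>?mid - {i}. demand I j p - C j)"
      unfolding competing_demand_def by (rule sum_partition) (use t' in auto)
    moreover have "sum y (bidders_from I (Suc t)) \<le> sum r {Suc t..num_tiers I}"
    proof (cases "t < num_tiers I")
      case True
      then show ?thesis using feasible unfolding feasible_for_iff by auto
    next
      case False
      then have "bidders_from I (Suc t) = {}"
        using tiered t' unfolding tiered_instance_def by fastforce
      then show ?thesis by (metis sum.empty zero_le)
    qed
    moreover have "sum r {1..num_tiers I} = sum r {1..t' - 1} + sum r {t'..num_tiers I}"
      by (rule sum_partition) (use t' in auto)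
    moreover have "sum r {1..num_tiers I} = sum r {1..t} + sum r {Suc t..num_tiers I}"
      by (rule sum_partition) (use t' in auto)
    ultimately show False using tight scarce covers by linarith
  qed
  then show ?thesis using that by blast
qed

text \<open>Here \<open>y\<close> counts units on top of the holdings \<open>C\<close>. The maximum
  is expressed as an attained upper bound, which spares a finiteness argument at every step.\<close>

definition residual_optimum ::
    "instance_data \<Rightarrow> (nat \<Rightarrow> nat) \<Rightarrow> (nat \<Rightarrow> nat) \<Rightarrow> nat \<Rightarrow> int \<Rightarrow> bool" where
  "residual_optimum I r C i v \<longleftrightarrow>
     (\<exists>y. feasible_for I r y \<and> y i = 0 \<and> others_value I i (\<lambda>a. C a + y a) = v) \<and>
     (\<forall>y. feasible_for I r y \<and> y i = 0 \<longrightarrow> others_value I i (\<lambda>a. C a + y a) \<le> v)"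

section \<open>Exchange arguments for a single clinch\<close>

text \<open>The situation just before bidder \<open>c\<close> clinches an item of tier
  \<open>s\<close> in submarket \<open>t\<close>. Coverage at the preceding price is not included;
  it is assumed only where it is used.\<close>

locale clinching =
  fixes I :: instance_data and r C :: "nat \<Rightarrow> nat" and p :: int and t c s :: nat
  assumes tiered: "tiered_instance I"
    and total: "sum C {1..num_bidders I} + sum r {1..num_tiers I} = total_supply I"
    and covers: "\<And>u. u \<le> num_tiers I \<Longrightarrow> sum r {1..u} \<le> competing_demand I C p {} u"
    and t: "t \<le> num_tiers I" "tier I c \<le> t"
    and c: "c \<in> {1..num_bidders I}"
    and scarce: "competing_demand I C p {c} t < sum r {1..t}"
    and s: "tier I c \<le> s" "s \<le> num_tiers I" "0 < r s" "\<And>k. tier I c \<le> k \<Longrightarrow> k < s \<Longrightarrow> r k = 0"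
begin

abbreviation sold :: "nat \<Rightarrow> nat" where
  "sold \<equiv> r(s := r s - 1)"

lemma tier_c: "1 \<le> tier I c" "tier I c \<le> num_tiers I"
  using tiered c unfolding tiered_instance_def by auto

text \<open>Below its own tier, \<open>c\<close> does not compete at all; from there up to
  \<open>s\<close> the tiers are empty and add no supply.\<close>

lemma supply_below:
  assumes "1 \<le> u" "u \<le> s"
  shows "sum r {1..u - 1} \<le> competing_demand I C p {c} (u - 1)"
proof (cases "u \<le> tier I c")
  case True
  have "sum r {1..u - 1} \<le> competing_demand I C p {} (u - 1)" using assms s by (intro covers) auto
  also have "\<dots> \<le> competing_demand I C p {c} (u - 1)"
    using True assms by (intro competing_demand_mono) auto
  finally show ?thesis .
next
  case False
  have "sum r {1..u - 1} = sum r {1..tier I c - 1}"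
    using False assms s(4) tier_c by (intro sum.mono_neutral_right) auto
  also have "\<dots> \<le> competing_demand I C p {} (tier I c - 1)" using tier_c by (intro covers) auto
  also have "\<dots> \<le> competing_demand I C p {c} (u - 1)"
    using False tier_c by (intro competing_demand_mono) auto
  finally show ?thesis .
qed

text \<open>The auction rule does not bound \<open>s\<close> by \<open>t\<close>. But if all tiers
  from that of \<open>c\<close> to \<open>t\<close> were empty, the other bidders would cover
  submarket \<open>t\<close>, contrary to \<open>scarce\<close>.\<close>

lemma s_le_t: "s \<le> t"
proof (rule ccontr)
  assume "\<not> s \<le> t"
  then have "sum r {1..Suc t - 1} \<le> competing_demand I C p {c} (Suc t - 1)"
    by (intro supply_below) auto
  then show False using scarce by simp
qed

text \<open>All bidders together cover submarket \<open>t\<close> and the others alone do not, so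
  \<open>c\<close> must contribute.\<close>

lemma clincher_demand: "C c < demand I c p"
proof -
  have "competing_demand I C p {} t = competing_demand I C p {c} t + (demand I c p - C c)"
    unfolding competing_demand_def using c t
    by (subst sum.remove[of _ c]) (auto simp: add.commute)
  then show ?thesis using scarce covers[OF t(1)] by linarith
qed

lemma sum_sold:
  assumes "finite A"
  shows "sum r A = sum sold A + (if s \<in> A then 1 else 0)"
  using assms s(3) by (rule sum_fun_upd_pred)

lemma sum_sold_from:
  "sum r {u..num_tiers I} = sum sold {u..num_tiers I} + (if u \<le> s then 1 else 0)"
  using sum_sold[of "{u..num_tiers I}"] s(2) by simp

text \<open>A bidder with more than its residual demand holds a last unit beyond its demand at
  \<open>p\<close>, hence worth at most \<open>p\<close>.\<close>

lemma excess_unit: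
  assumes y: "feasible_for I r y" "y c = 0"
    and tight: "1 \<le> u" "u \<le> s" "sum y (bidders_from I u) = sum r {u..num_tiers I}"
  obtains j where "j \<in> {1..num_bidders I}" "j \<noteq> c" "u \<le> tier I j" "0 < y j"
    "valuation I j (C j + y j) \<le> p"
proof -
  obtain j where j: "j \<in> {1..num_bidders I}" "j \<noteq> c" "u \<le> tier I j" "demand I j p - C j < y j"
    by (rule tight_exceeds_demand[OF tiered y(1) tight(3) tight(1) _ t(1) y(2) scarce
          supply_below[OF tight(1,2)]]) (use tight(2) s_le_t in auto)
  have "C j + y j \<in> {1..total_supply I}"
    using feasible_within_total[OF tiered y(1) j(1) total] j(4) by auto
  from demand_iff[OF tiered j(1) this, of p] have "valuation I j (C j + y j) \<le> p"
    using j(4) by linarith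
  then show ?thesis using that j by auto
qed

text \<open>If the clinched item is needed, the last tight tier constraint at or below it contains a bidder
  holding more than its residual demand, so giving up one of its units costs at most \<open>p\<close>.\<close>

lemma release_item:
  assumes y: "feasible_for I r y" "y c = 0" and "0 \<le> p"
  obtains y' where "feasible_for I sold y'" "y' c = 0"
    "others_value I c (\<lambda>a. C a + y a) \<le> others_value I c (\<lambda>a. C a + y' a) + p"
proof (cases "feasible_for I sold y")
  case True
  then show ?thesis using that[of y] assms by simp
next
  case False
  define tight where "tight u \<longleftrightarrow> 1 \<le> u \<and> sum y (bidders_from I u) = sum r {u..num_tiers I}" for u
  have le: "sum y (bidders_from I u) \<le> sum r {u..num_tiers I}"
    if "1 \<le> u" "u \<le> num_tiers I" for u using y(1) that unfolding feasible_for_iff by auto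
  from False obtain u0 where u0: "u0 \<in> {1..num_tiers I}"
      "sum sold {u0..num_tiers I} < sum y (bidders_from I u0)"
    unfolding feasible_for_iff by (meson not_le)
  \<comment> \<open>The sale reduces a supply bound by just one, and only up to \<open>s\<close>, so
    a constraint that it violates was tight and lies there.\<close>
  then have tight0: "tight u0" "u0 \<le> s"
    using sum_sold[of "{u0..num_tiers I}"] le[of u0] by (auto simp: tight_def split: if_splits)
  obtain u where u: "u \<le> s" "tight u" "\<And>v. u < v \<Longrightarrow> v \<le> s \<Longrightarrow> \<not> tight v"
    using exists_last_le[of tight, OF tight0] by blast
  obtain j where j: "j \<in> {1..num_bidders I}" "j \<noteq> c" "u \<le> tier I j" "0 < y j"
      "valuation I j (C j + y j) \<le> p"
    by (rule excess_unit[OF y, of u]) (use u(1,2) in \<open>auto simp: tight_def\<close>)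
  let ?y = "y(j := y j - 1)"
  have "feasible_for I sold ?y"
    unfolding feasible_for_iff
  proof
    fix v assume v: "v \<in> {1..num_tiers I}"
    have remove: "sum y (bidders_from I v) = sum ?y (bidders_from I v) + (if j \<in> bidders_from I v then 1 else 0)"
      by (rule sum_fun_upd_pred[of _ y j]) (use j(4) in auto)
    have le': "sum y (bidders_from I v) \<le> sum r {v..num_tiers I}" using le v by simp
    \<comment> \<open>Up to \<open>u\<close> the released unit offsets the sold item; between
      \<open>u\<close> and \<open>s\<close> there is slack by the choice of \<open>u\<close>; above
      \<open>s\<close> the supply is unchanged.\<close>
    consider "v \<le> u" | "u < v" "v \<le> s" | "s < v" by linarith
    then show "sum ?y (bidders_from I v) \<le> sum sold {v..num_tiers I}"
    proof cases
      case 1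
      then have "j \<in> bidders_from I v" using j(1,3) by auto
      then have "sum y (bidders_from I v) = sum ?y (bidders_from I v) + 1" using remove by presburger
      moreover have "sum r {v..num_tiers I} = sum sold {v..num_tiers I} + 1"
        using sum_sold_from[of v] 1 u(1) by presburger
      ultimately show ?thesis using le' by linarith
    next
      case 2
      then have "sum y (bidders_from I v) \<noteq> sum r {v..num_tiers I}" using u(3)[OF 2] v by (auto simp: tight_def)
      moreover have "sum r {v..num_tiers I} = sum sold {v..num_tiers I} + 1"
        using sum_sold_from[of v] 2 by presburger
      ultimately show ?thesis using remove le' by linarith
    next
      case 3
      then have "sum r {v..num_tiers I} = sum sold {v..num_tiers I}"
        using sum_sold_from[of v] by presburger
      then show ?thesis using remove le' by linarith
    qed
  qed
  moreover have "?y c = 0" using y(2) j(2) by simp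
  moreover have "others_value I c (\<lambda>a. C a + y a) \<le> others_value I c (\<lambda>a. C a + ?y a) + p"
    using others_value_add_pred[of y j I c C, OF j(4)] j by simp
  ultimately show ?thesis by (rule that)
qed

text \<open>Conversely, below the first tight constraint above tier \<open>s\<close> not all units are used, while the
  other bidders still want, at price \<open>p - 1\<close>, at least the supply there.\<close>

lemma absorb_item:
  assumes y: "feasible_for I sold y" "y c = 0"
    and prev: "\<And>u. u \<le> num_tiers I \<Longrightarrow> sum r {1..u} \<le> competing_demand I C (p - 1) {c} u"
  obtains y' where "feasible_for I r y'" "y' c = 0"
    "others_value I c (\<lambda>a. C a + y a) + p \<le> others_value I c (\<lambda>a. C a + y' a)"
proof -
  let ?L = "num_tiers I"
  let ?tight = "\<lambda>u. s < u \<and> sum y (bidders_from I u) = sum r {u..?L}"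
  have le: "sum y (bidders_from I u) \<le> sum sold {u..?L}" if "1 \<le> u" "u \<le> ?L" for u
    using y(1) that unfolding feasible_for_iff by auto
  have "bidders_from I (Suc ?L) = {}" using tiered unfolding tiered_instance_def by fastforce
  then have "sum y (bidders_from I (Suc ?L)) = 0" by (metis sum.empty)
  \<comment> \<open>Beyond the last tier there are neither bidders nor items, so a tight constraint
    above \<open>s\<close> always exists.\<close>
  then have end_tight: "?tight (Suc ?L)" using s(2) by simp
  define b where "b = (LEAST u. ?tight u)"
  have b: "s < b" "sum y (bidders_from I b) = sum r {b..?L}" "b \<le> Suc ?L"
    using LeastI[of ?tight, OF end_tight] Least_le[of ?tight, OF end_tight] by (auto simp: b_def)
  have not_tight: "sum y (bidders_from I u) \<noteq> sum r {u..?L}" if "s < u" "u < b" for u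
    using not_less_Least[of u ?tight] that by (auto simp: b_def)
  have s1: "1 \<le> s" using tier_c s by linarith
  let ?low = "{j \<in> {1..num_bidders I}. tier I j \<le> b - 1}"
  \<comment> \<open>Otherwise the bidders below \<open>b\<close> would use all the supply there, and
    with tightness at \<open>b\<close> all of \<open>r\<close>, although \<open>y\<close> fits into
    \<open>sold\<close>, which has one item fewer.\<close>
  have "\<exists>j\<in>?low - {c}. y j < demand I j (p - 1) - C j"
  proof (rule ccontr)
    assume "\<not> ?thesis"
    then have "competing_demand I C (p - 1) {c} (b - 1) \<le> sum y (?low - {c})"
      unfolding competing_demand_def by (intro sum_mono) (meson not_le)
    moreover have "sum y (?low - {c}) \<le> sum y ?low" by (intro sum_mono2) auto
    moreover have "sum y (bidders_from I 1) = sum y ?low + sum y (bidders_from I b)"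
      by (rule sum_partition) (use b(1) tiered in \<open>auto simp: tiered_instance_def\<close>)
    moreover have "sum r {1..?L} = sum r {1..b - 1} + sum r {b..?L}"
      by (rule sum_partition) (use b in auto)
    moreover have "sum r {1..b - 1} \<le> competing_demand I C (p - 1) {c} (b - 1)"
      using b(3) by (intro prev) auto
    moreover have "sum y (bidders_from I 1) < sum r {1..?L}"
      using le[of 1] sum_sold[of "{1..?L}"] s1 s(2) by auto
    ultimately show False using b(2) by linarith
  qed
  then obtain j where j: "j \<in> {1..num_bidders I}" "j \<noteq> c" "tier I j \<le> b - 1"
      "y j < demand I j (p - 1) - C j" by blast
  let ?y = "y(j := Suc (y j))"
  have "demand I j (p - 1) \<le> total_supply I"
    unfolding demand_def by (rule order_trans[OF card_mono[of "{1..total_supply I}"]]) auto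
  then have "p - 1 < valuation I j (Suc (C j + y j))"
    using j(4) by (subst demand_iff[OF tiered j(1)]) auto
  then have "others_value I c (\<lambda>a. C a + y a) + p \<le> others_value I c (\<lambda>a. C a + ?y a)"
    using others_value_add_Suc[of I c C y j] j by simp
  moreover have "?y c = 0" using y(2) j(2) by simp
  moreover have "feasible_for I r ?y"
    unfolding feasible_for_iff
  proof
    fix v assume v: "v \<in> {1..?L}"
    have add: "sum ?y (bidders_from I v) = sum y (bidders_from I v) + (if j \<in> bidders_from I v then 1 else 0)"
      by (rule sum_fun_upd_Suc) simp
    moreover have "(if j \<in> bidders_from I v then 1 else 0) \<le> (1::nat)" by simp
    ultimately have add_le: "sum ?y (bidders_from I v) \<le> sum y (bidders_from I v) + 1" by linarith
    have le': "sum y (bidders_from I v) \<le> sum sold {v..?L}" using le v by simp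
    \<comment> \<open>The new unit does not count from \<open>b\<close> on; between \<open>s\<close>
      and \<open>b\<close> there is slack by minimality of \<open>b\<close>; up to \<open>s\<close>
      the returned item makes room.\<close>
    consider "b \<le> v" | "s < v" "v < b" | "v \<le> s" by linarith
    then show "sum ?y (bidders_from I v) \<le> sum r {v..?L}"
    proof cases
      case 1
      then have "j \<notin> bidders_from I v" using j(3) b(1) by auto
      then have "sum ?y (bidders_from I v) = sum y (bidders_from I v)" using add by presburger
      then show ?thesis using le' sum_sold_from[of v] by linarith
    next
      case 2
      then have "sum y (bidders_from I v) < sum r {v..?L}"
        using not_tight[OF 2] le' sum_sold_from[of v] by linarith
      then show ?thesis using add_le by linarith
    next
      case 3
      then have "sum r {v..?L} = sum sold {v..?L} + 1" using sum_sold_from[of v] by presburger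
      then show ?thesis using add_le le' by linarith
    qed
  qed
  ultimately show ?thesis using that by blast
qed

text \<open>Some optimal allocation gives the clinching bidder an item: its next unit is worth more than \<open>p\<close>
  and, under a tight constraint, can replace a unit worth at most \<open>p\<close>.\<close>

lemma clincher_served:
  assumes y: "feasible_for I r y" "y i = 0" and i: "i \<noteq> c"
  obtains y' where "feasible_for I r y'" "y' i = 0" "0 < y' c"
    "others_value I i (\<lambda>a. C a + y a) \<le> others_value I i (\<lambda>a. C a + y' a)"
proof (cases "y c = 0")
  case False
  then show ?thesis using that[of y] y by simp
next
  case True
  let ?L = "num_tiers I"
  define tight where "tight u \<longleftrightarrow> 1 \<le> u \<and> sum y (bidders_from I u) = sum r {u..?L}" for u
  have le: "sum y (bidders_from I u) \<le> sum r {u..?L}" if "1 \<le> u" "u \<le> ?L" for u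
    using y(1) that unfolding feasible_for_iff by auto
  have "demand I c p \<le> total_supply I"
    unfolding demand_def by (rule order_trans[OF card_mono[of "{1..total_supply I}"]]) auto
  then have worth: "p < valuation I c (Suc (C c))"
    using demand_iff[OF tiered c, of "Suc (C c)" p] clincher_demand by auto
  show ?thesis
  proof (cases "\<exists>u\<le>tier I c. tight u")
    case False
    \<comment> \<open>Every constraint that involves \<open>c\<close> has slack, so \<open>c\<close>
      receives a unit without anyone giving one up.\<close>
    let ?y = "y(c := Suc (y c))"
    have "feasible_for I r ?y"
      unfolding feasible_for_iff
    proof
      fix v assume v: "v \<in> {1..?L}"
      have "sum ?y (bidders_from I v) = sum y (bidders_from I v) + (if c \<in> bidders_from I v then 1 else 0)"
        by (rule sum_fun_upd_Suc) simp
      moreover have "sum y (bidders_from I v) \<noteq> sum r {v..?L}" if "v \<le> tier I c"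
        using False that v by (auto simp: tight_def)
      ultimately show "sum ?y (bidders_from I v) \<le> sum r {v..?L}"
        using le[of v] v by (cases "v \<le> tier I c") auto
    qed
    moreover have "0 \<le> valuation I c (Suc (C c))"
      using tiered c clincher_demand \<open>demand I c p \<le> total_supply I\<close>
      unfolding tiered_instance_def by auto
    then have "others_value I i (\<lambda>a. C a + y a) \<le> others_value I i (\<lambda>a. C a + ?y a)"
      using others_value_add_Suc[of I i C y c] True by simp
    ultimately show ?thesis using that[of ?y] y(2) i by simp
  next
    case exists_tight: True
    then obtain u0 where tight0: "tight u0" "u0 \<le> tier I c" by blast
    obtain u where u: "u \<le> tier I c" "tight u" "\<And>v. u < v \<Longrightarrow> v \<le> tier I c \<Longrightarrow> \<not> tight v"
      using exists_last_le[of tight, OF tight0] by blast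
    obtain j where j: "j \<in> {1..num_bidders I}" "j \<noteq> c" "u \<le> tier I j" "0 < y j"
        "valuation I j (C j + y j) \<le> p"
      by (rule excess_unit[OF y(1) True, of u]) (use u(1,2) s(1) in \<open>auto simp: tight_def\<close>)
    let ?z = "y(j := y j - 1)"
    let ?y = "?z(c := Suc (?z c))"
    have "feasible_for I r ?y"
      unfolding feasible_for_iff
    proof
      fix v assume v: "v \<in> {1..?L}"
      have add: "sum ?y (bidders_from I v) = sum ?z (bidders_from I v) + (if c \<in> bidders_from I v then 1 else 0)"
        by (rule sum_fun_upd_Suc) simp
      moreover have "(if c \<in> bidders_from I v then 1 else 0) \<le> (1::nat)" by simp
      ultimately have add_le: "sum ?y (bidders_from I v) \<le> sum ?z (bidders_from I v) + 1" by linarith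
      have remove: "sum y (bidders_from I v) = sum ?z (bidders_from I v) + (if j \<in> bidders_from I v then 1 else 0)"
        by (rule sum_fun_upd_pred[of _ y j]) (use j(4) in auto)
      have le': "sum y (bidders_from I v) \<le> sum r {v..?L}" using le v by simp
      \<comment> \<open>Up to \<open>u\<close> the swap is neutral; between \<open>u\<close> and the
        tier of \<open>c\<close> there is slack by the choice of \<open>u\<close>; above it the unit
        of \<open>c\<close> does not count.\<close>
      consider "v \<le> u" | "u < v" "v \<le> tier I c" | "tier I c < v" by linarith
      then show "sum ?y (bidders_from I v) \<le> sum r {v..?L}"
      proof cases
        case 1
        then have "j \<in> bidders_from I v" using j(1,3) by auto
        then have "sum y (bidders_from I v) = sum ?z (bidders_from I v) + 1" using remove by presburger
        then show ?thesis using add_le le' by linarith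
      next
        case 2
        then have "sum y (bidders_from I v) \<noteq> sum r {v..?L}" using u(3)[OF 2] v by (auto simp: tight_def)
        then show ?thesis using add_le remove le' by linarith
      next
        case 3
        then have "c \<notin> bidders_from I v" by auto
        then have "sum ?y (bidders_from I v) = sum ?z (bidders_from I v)" using add by presburger
        then show ?thesis using remove le' by linarith
      qed
    qed
    moreover have "?y i = 0" "0 < ?y c" using y(2) i j by auto
    moreover have "j \<noteq> i" using j(4) y(2) by auto
    then have "others_value I i (\<lambda>a. C a + y a) \<le> others_value I i (\<lambda>a. C a + ?y a)"
      using others_value_add_pred[of y j I i C, OF j(4)] others_value_add_Suc[of I i C ?z c]
        True j i c worth by simp
    ultimately show ?thesis by (rule that)
  qed
qed

lemma feasible_unsold:
  assumes "feasible_for I sold y"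
  shows "feasible_for I r y"
  using assms sum_sold_from unfolding feasible_for_iff by (metis trans_le_add1)

text \<open>\<open>release_item\<close> shows that \<open>v - p\<close> can still be reached,
  \<open>absorb_item\<close> that no more can. At price \<open>0\<close> the upper bound needs only
  that \<open>sold\<close> is a smaller supply than \<open>r\<close>.\<close>

lemma residual_optimum_clincher:
  assumes opt: "residual_optimum I r C c v" and "0 \<le> p"
    and prev: "\<And>u. 0 < p \<Longrightarrow> u \<le> num_tiers I \<Longrightarrow>
      sum r {1..u} \<le> competing_demand I C (p - 1) {c} u"
  shows "residual_optimum I sold (C(c := C c + 1)) c (v - p)"
proof -
  \<comment> \<open>The holding of \<open>c\<close> itself does not enter the value of the
    others.\<close>
  have own: "others_value I c (\<lambda>a. (C(c := C c + 1)) a + y a) = others_value I c (\<lambda>a. C a + y a)"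
    for y unfolding others_value_def by (rule sum.cong) auto
  obtain y where y: "feasible_for I r y" "y c = 0" "others_value I c (\<lambda>a. C a + y a) = v"
    using opt unfolding residual_optimum_def by blast
  obtain y' where y': "feasible_for I sold y'" "y' c = 0"
      "others_value I c (\<lambda>a. C a + y a) \<le> others_value I c (\<lambda>a. C a + y' a) + p"
    using release_item[OF y(1,2) \<open>0 \<le> p\<close>] by blast
  have upper: "others_value I c (\<lambda>a. C a + z a) \<le> v - p"
    if z: "feasible_for I sold z" "z c = 0" for z
  proof -
    obtain z' where z': "feasible_for I r z'" "z' c = 0"
        "others_value I c (\<lambda>a. C a + z a) + p \<le> others_value I c (\<lambda>a. C a + z' a)"
    proof (cases "0 < p")
      case True
      then show ?thesis using absorb_item[OF z prev] that by blast
    next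
      case False
      then show ?thesis using that[of z] feasible_unsold z \<open>0 \<le> p\<close> by simp
    qed
    moreover from z'(1,2) have "others_value I c (\<lambda>a. C a + z' a) \<le> v"
      using opt unfolding residual_optimum_def by blast
    ultimately show ?thesis by linarith
  qed
  have "others_value I c (\<lambda>a. C a + y' a) = v - p" using y(3) y' upper[OF y'(1,2)] by linarith
  then show ?thesis unfolding residual_optimum_def own using y' upper by blast
qed

text \<open>For \<open>i\<close> the clinch only moves one unit of \<open>c\<close> from the plan
  \<open>y\<close> into the holdings \<open>C\<close>, so \<open>C + y\<close> is unchanged. Such a
  unit can be found in some optimal plan by \<open>clincher_served\<close>.\<close>

lemma residual_optimum_other:
  assumes opt: "residual_optimum I r C i v" and i: "i \<noteq> c"
  shows "residual_optimum I sold (C(c := C c + 1)) i v"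
proof -
  let ?L = "num_tiers I"
  have shift: "(\<lambda>a. (C(c := C c + 1)) a + y a) = (\<lambda>a. C a + (y(c := Suc (y c))) a)" for y
    by auto
  have feasible_add: "feasible_for I r (y(c := Suc (y c)))" if y: "feasible_for I sold y" for y
    unfolding feasible_for_iff
  proof
    fix v assume v: "v \<in> {1..?L}"
    have add: "sum (y(c := Suc (y c))) (bidders_from I v) =
        sum y (bidders_from I v) + (if c \<in> bidders_from I v then 1 else 0)"
      by (rule sum_fun_upd_Suc) simp
    have le: "sum y (bidders_from I v) \<le> sum sold {v..?L}"
      using y v unfolding feasible_for_iff by blast
    show "sum (y(c := Suc (y c))) (bidders_from I v) \<le> sum r {v..?L}"
    proof (cases "c \<in> bidders_from I v")
      case True
      then have "v \<le> s" using s(1) by simp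
      then have "sum r {v..?L} = sum sold {v..?L} + 1" using sum_sold_from[of v] by presburger
      moreover have "sum (y(c := Suc (y c))) (bidders_from I v) = sum y (bidders_from I v) + 1"
        using add True by presburger
      ultimately show ?thesis using le by linarith
    next
      case False
      then have "sum (y(c := Suc (y c))) (bidders_from I v) = sum y (bidders_from I v)"
        using add by presburger
      then show ?thesis using le sum_sold_from[of v] by linarith
    qed
  qed
  have feasible_remove: "feasible_for I sold (y(c := y c - 1))"
    if y: "feasible_for I r y" and pos: "0 < y c" for y
    unfolding feasible_for_iff
  proof
    fix v assume v: "v \<in> {1..?L}"
    have remove: "sum y (bidders_from I v) =
        sum (y(c := y c - 1)) (bidders_from I v) + (if c \<in> bidders_from I v then 1 else 0)"
      by (rule sum_fun_upd_pred[of _ y c]) (use pos in auto)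
    have le: "sum y (bidders_from I u) \<le> sum r {u..?L}" if "u \<in> {1..?L}" for u
      using y that unfolding feasible_for_iff by blast
    consider "v \<le> tier I c" | "tier I c < v" "v \<le> s" | "s < v" by linarith
    then show "sum (y(c := y c - 1)) (bidders_from I v) \<le> sum sold {v..?L}"
    proof cases
      case 1
      then have "c \<in> bidders_from I v" using c by simp
      then have "sum y (bidders_from I v) = sum (y(c := y c - 1)) (bidders_from I v) + 1"
        using remove by presburger
      moreover have "sum r {v..?L} \<le> sum sold {v..?L} + 1" using sum_sold_from[of v] by presburger
      ultimately show ?thesis using le[OF v] by linarith
    next
      case 2
      \<comment> \<open>The tiers from that of \<open>c\<close> up to \<open>v\<close> are empty, so
        the bidders from \<open>v\<close> on must share the same supply with \<open>c\<close>, whose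
        positive share leaves them the missing slack.\<close>
      have "sum y (insert c (bidders_from I v)) \<le> sum y (bidders_from I (tier I c))"
        using 2 c by (intro sum_mono2) auto
      moreover have "sum y (insert c (bidders_from I v)) = y c + sum y (bidders_from I v)"
        using 2 by (intro sum.insert) auto
      moreover have "sum y (bidders_from I (tier I c)) \<le> sum r {tier I c..?L}"
        using tier_c by (intro le) auto
      moreover have "sum r {tier I c..?L} = sum r {v..?L}"
        using 2 s(4) by (intro sum.mono_neutral_right) auto
      moreover have "sum r {v..?L} = sum sold {v..?L} + 1"
        using 2 sum_sold_from[of v] by presburger
      ultimately show ?thesis using pos remove by linarith
    next
      case 3
      then have "sum r {v..?L} = sum sold {v..?L}" using sum_sold_from[of v] by presburger
      then show ?thesis using le[OF v] remove by linarith
    qed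
  qed
  have upper: "others_value I i (\<lambda>a. C a + (y(c := Suc (y c))) a) \<le> v"
    if "feasible_for I sold y" "y i = 0" for y
  proof -
    have "(y(c := Suc (y c))) i = 0" using that i by simp
    then show ?thesis using opt feasible_add[OF that(1)] unfolding residual_optimum_def by blast
  qed
  obtain y where y: "feasible_for I r y" "y i = 0" "others_value I i (\<lambda>a. C a + y a) = v"
    using opt unfolding residual_optimum_def by blast
  obtain y' where y': "feasible_for I r y'" "y' i = 0" "0 < y' c"
      "others_value I i (\<lambda>a. C a + y a) \<le> others_value I i (\<lambda>a. C a + y' a)"
    using clincher_served[OF y(1,2) i] by blast
  let ?z = "y'(c := y' c - 1)"
  have "?z(c := Suc (?z c)) = y'" using y'(3) by auto
  moreover have "others_value I i (\<lambda>a. C a + y' a) \<le> v"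
    using opt y'(1,2) unfolding residual_optimum_def by blast
  ultimately have "others_value I i (\<lambda>a. C a + (?z(c := Suc (?z c))) a) = v"
    using y(3) y'(4) by simp
  moreover have "?z i = 0" using i y'(2) by simp
  ultimately show ?thesis
    unfolding residual_optimum_def shift using feasible_remove[OF y'(1,3)] upper by blast
qed

end

section \<open>Invariance under clinching and termination\<close>

lemma clinchingI:
  assumes "tiered_instance I" "market_invariant I S" "can_clinch I S t c" "lowest_available I S c s"
  shows "clinching I (remaining S) (clinched S) (price S) t c s"
  using assms
  unfolding clinching_def market_invariant_def can_clinch_iff lowest_available_def by auto

lemma market_invariant_clinch:
  assumes "tiered_instance I" "market_invariant I S" "can_clinch I S t c" "lowest_available I S c s"
  shows "market_invariant I (assign_item c s S)"
proof -
  interpret clinching I "remaining S" "clinched S" "price S" t c s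
    using assms by (rule clinchingI)
  \<comment> \<open>Needed twice: at the current price with nobody excluded, and at the preceding
    price with an arbitrary single bidder excluded.\<close>
  have keep: "sum sold {1..u} \<le> competing_demand I ((clinched S)(c := clinched S c + 1)) p' X u"
    if "\<And>u. u \<le> num_tiers I \<Longrightarrow> sum (remaining S) {1..u} \<le> competing_demand I (clinched S) p' X u"
      "u \<le> num_tiers I" for p' X u
    by (rule clinching_covers_supply[OF that(1) tier_c(1) s(1,3) _ that(2)]) (use s(4) in auto)
  have "sum ((clinched S)(c := clinched S c + 1)) {1..num_bidders I} = sum (clinched S) {1..num_bidders I} + 1"
    using sum_fun_upd_Suc[of "{1..num_bidders I}" "clinched S" c] c by simp
  moreover have "sum (remaining S) {1..num_tiers I} = sum sold {1..num_tiers I} + 1"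
    using sum_sold_from[of 1] tier_c s(1) by simp
  ultimately have "sum ((clinched S)(c := clinched S c + 1)) {1..num_bidders I}
      + sum sold {1..num_tiers I} = total_supply I" using total by linarith
  then show ?thesis
    using assms(2) keep unfolding market_invariant_def assign_item_def by simp
qed

text \<open>Shows that a run never gets stuck at a clinch: were the tiers from that of
  \<open>c\<close> to \<open>t\<close> empty, the bidders below would cover the submarket and
  \<open>c\<close> could not clinch.\<close>

lemma lowest_available_exists:
  assumes "tiered_instance I" "market_invariant I S" "can_clinch I S t c"
  obtains s where "lowest_available I S c s"
proof -
  let ?P = "\<lambda>s. tier I c \<le> s \<and> s \<le> t \<and> 0 < remaining S s"
  have c: "c \<in> {1..num_bidders I}" "tier I c \<le> t" "t \<le> num_tiers I"
    using assms(3) unfolding can_clinch_iff by auto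
  have tier: "1 \<le> tier I c" using assms(1) c(1) unfolding tiered_instance_def by auto
  have "\<exists>s. ?P s"
  proof (rule ccontr)
    assume none: "\<nexists>s. ?P s"
    have "sum (remaining S) {1..t} = sum (remaining S) {1..tier I c - 1}"
      using none c(2) tier by (intro sum.mono_neutral_right) auto
    also have "\<dots> \<le> competing_demand I (clinched S) (price S) {} (tier I c - 1)"
      using assms(2) c unfolding market_invariant_def by auto
    also have "\<dots> \<le> competing_demand I (clinched S) (price S) {c} t"
      using c(2) tier by (intro competing_demand_mono) auto
    finally show False using assms(3) unfolding can_clinch_iff by simp
  qed
  then have P: "?P (LEAST s. ?P s)" by (rule LeastI_ex)
  have "remaining S k = 0" if "tier I c \<le> k" "k < (LEAST s. ?P s)" for k
    using not_less_Least[OF that(2)] P that by simp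
  then have "lowest_available I S c (LEAST s. ?P s)"
    using P c(3) unfolding lowest_available_def by auto
  then show ?thesis by (rule that)
qed

lemma first_clinch_exists:
  assumes "can_clinch I S t i"
  obtains t' i' where "first_clinch I S t' i'"
proof -
  define t' where "t' = (LEAST t. \<exists>i. can_clinch I S t i)"
  have "\<exists>i. can_clinch I S t' i" unfolding t'_def by (rule LeastI_ex) (use assms in blast)
  then have "can_clinch I S t' (LEAST i. can_clinch I S t' i)" by (rule LeastI_ex)
  moreover have "t' \<le> u" if "can_clinch I S u j" for u j
    unfolding t'_def by (rule Least_le) (use that in blast)
  moreover have "(LEAST i. can_clinch I S t' i) \<le> j" if "can_clinch I S t' j" for j
    using that by (rule Least_le)
  ultimately have "first_clinch I S t' (LEAST i. can_clinch I S t' i)"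
    unfolding first_clinch_def by (metis le_neq_implies_less)
  then show ?thesis by (rule that)
qed

text \<open>Unsold items force positive residual demand, so the price cannot outgrow the valuations
  while supply is left.\<close>

lemma price_below_valuation:
  assumes "market_invariant I S" "\<not> sold_out I S"
  obtains i k where "i \<in> {1..num_bidders I}" "k \<in> {1..total_supply I}" "price S < valuation I i k"
proof -
  have "0 < sum (remaining S) {1..num_tiers I}"
    using assms(2) unfolding sold_out_def by (metis finite_atLeastAtMost neq0_conv sum_eq_0_iff)
  also have "\<dots> \<le> competing_demand I (clinched S) (price S) {} (num_tiers I)"
    using assms(1) unfolding market_invariant_def by blast
  finally have "competing_demand I (clinched S) (price S) {} (num_tiers I) \<noteq> 0" by simp
  then obtain i where i: "i \<in> {1..num_bidders I}" "0 < demand I i (price S)"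
    unfolding competing_demand_def by (elim sum.not_neutral_contains_not_neutral) auto
  then have "{k \<in> {1..total_supply I}. price S < valuation I i k} \<noteq> {}"
    unfolding demand_def by (metis card.empty less_irrefl)
  then show ?thesis using that i(1) by blast
qed

text \<open>The measure is the gap between the price and the largest valuation plus the number of
  unsold items: a clinch lowers the second term, a price rise the first.\<close>

lemma auction_terminates:
  assumes "tiered_instance I" "distinct_valuations I" "market_invariant I S"
  shows "\<exists>S'. (auction_step I)\<^sup>*\<^sup>* S S' \<and> (\<forall>t i. \<not> can_clinch I S' t i) \<and> sold_out I S'"
proof -
  \<comment> \<open>Inserting \<open>0\<close> keeps the maximum defined when there are no bidders
    or no items.\<close>
  define M where "M = Max (insert 0 ((\<lambda>(i, k). valuation I i k) `
      ({1..num_bidders I} \<times> {1..total_supply I})))"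
  have M: "valuation I i k \<le> M" if "i \<in> {1..num_bidders I}" "k \<in> {1..total_supply I}" for i k
    unfolding M_def using that by (intro Max_ge) auto
  show ?thesis
    using assms(3)
  proof (induction "nat (M - price S) + sum (remaining S) {1..num_tiers I}" arbitrary: S
      rule: less_induct)
    case less
    have extend: ?case if "auction_step I S T" "market_invariant I T"
      "nat (M - price T) + sum (remaining T) {1..num_tiers I}
        < nat (M - price S) + sum (remaining S) {1..num_tiers I}" for T
      using less.hyps[OF that(3,2)] that(1) by (meson converse_rtranclp_into_rtranclp)
    show ?case
    proof (cases "\<exists>t i. can_clinch I S t i")
      case True
      then obtain t i where first: "first_clinch I S t i" using first_clinch_exists by blast
      then have can: "can_clinch I S t i" unfolding first_clinch_def by blast
      obtain s where low: "lowest_available I S i s"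
        using lowest_available_exists[OF assms(1) less.prems can] by blast
      interpret clinching I "remaining S" "clinched S" "price S" t i s
        using assms(1) less.prems can low by (rule clinchingI)
      have "sum (remaining S) {1..num_tiers I} = sum sold {1..num_tiers I} + 1"
        using sum_sold_from[of 1] tier_c s(1) by simp
      then show ?thesis
        using auction_step.clinch[OF first low] market_invariant_clinch[OF assms(1) less.prems can low]
        by (intro extend) (auto simp: assign_item_def)
    next
      case False
      show ?thesis
      proof (cases "sold_out I S")
        case True
        then show ?thesis using False by blast
      next
        case unsold: False
        obtain i k where "i \<in> {1..num_bidders I}" "k \<in> {1..total_supply I}" "price S < valuation I i k"
          using price_below_valuation[OF less.prems unsold] by blast
        then have "price S < M" using M by fastforce
        moreover have "auction_step I S (S\<lparr>price := price S + 1\<rparr>)"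
          using False unsold by (intro auction_step.raise_price) auto
        moreover have "market_invariant I (S\<lparr>price := price S + 1\<rparr>)"
          using False by (intro market_invariant_raise[OF assms(2) less.prems]) auto
        ultimately show ?thesis by (intro extend) auto
      qed
    qed
  qed
qed

section \<open>Payments as externalities\<close>

definition payment_invariant :: "instance_data \<Rightarrow> auction_state \<Rightarrow> bool" where
  "payment_invariant I S \<longleftrightarrow>
     market_invariant I S \<and>
     (\<forall>i\<in>{1..num_bidders I}. residual_optimum I (remaining S) (clinched S) i
        (Max {others_value I i y | y. feasible I y \<and> y i = 0} - paid S i))"

lemma payment_invariant_initial:
  assumes "tiered_instance I" "not_undersubscribed I"
  shows "payment_invariant I (initial_state I)"
proof -
  have "residual_optimum I (tier_supply I) (\<lambda>_. 0) i
      (Max {others_value I i y | y. feasible I y \<and> y i = 0})" for i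
    using Max_in[OF finite_others_values[OF assms(1)] nonempty_others_values, of i]
      Max_ge[OF finite_others_values[OF assms(1)], of _ i]
    unfolding residual_optimum_def by auto
  then show ?thesis
    using market_invariant_initial[OF assms]
    unfolding payment_invariant_def by (simp add: initial_state_def)
qed

lemma payment_invariant_step:
  assumes "tiered_instance I" "distinct_valuations I" "payment_invariant I S" "auction_step I S T"
  shows "payment_invariant I T"
  using assms(4)
proof cases
  case (clinch t c s)
  have market: "market_invariant I S" using assms(3) unfolding payment_invariant_def by blast
  have can: "can_clinch I S t c" using clinch(2) unfolding first_clinch_def by blast
  interpret clinching I "remaining S" "clinched S" "price S" t c s
    using assms(1) market can clinch(3) by (rule clinchingI)
  let ?V = "\<lambda>i. Max {others_value I i y | y. feasible I y \<and> y i = 0}"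
  have "residual_optimum I sold ((clinched S)(c := clinched S c + 1)) i
      (?V i - (if i = c then paid S c + price S else paid S i))"
    if i: "i \<in> {1..num_bidders I}" for i
  proof -
    have opt: "residual_optimum I (remaining S) (clinched S) i (?V i - paid S i)"
      using assms(3) i unfolding payment_invariant_def by blast
    show ?thesis
    proof (cases "i = c")
      case True
      have "residual_optimum I sold ((clinched S)(c := clinched S c + 1)) c (?V c - paid S c - price S)"
        using opt True market unfolding market_invariant_def
        by (intro residual_optimum_clincher) auto
      then show ?thesis using True by (simp add: algebra_simps)
    next
      case False
      then show ?thesis using residual_optimum_other[OF opt] by simp
    qed
  qed
  then show ?thesis
    using market_invariant_clinch[OF assms(1) market can clinch(3)] clinch(1)
    unfolding payment_invariant_def by (simp add: assign_item_def)
next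
  case raise_price
  then show ?thesis
    using assms(3) market_invariant_raise[OF assms(2)] unfolding payment_invariant_def by simp
qed

text \<open>With no supply left, a feasible plan gives every bidder zero further units, so the
  optimum is the value of the holdings.\<close>

lemma residual_optimum_sold_out:
  assumes "tiered_instance I" "residual_optimum I r C i v" "\<forall>k\<in>{1..num_tiers I}. r k = 0"
  shows "others_value I i C = v"
proof -
  obtain y where y: "feasible_for I r y" "others_value I i (\<lambda>a. C a + y a) = v"
    using assms(2) unfolding residual_optimum_def by blast
  have "y j = 0" if j: "j \<in> {1..num_bidders I}" for j
  proof -
    have t: "tier I j \<in> {1..num_tiers I}" using assms(1) j unfolding tiered_instance_def by blast
    have "y j \<le> sum y (bidders_from I (tier I j))" using j by (intro member_le_sum) auto
    also have "\<dots> \<le> sum r {tier I j..num_tiers I}" using y(1) t unfolding feasible_for_iff by blast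
    also have "\<dots> = 0" using assms(3) t by (intro sum.neutral) auto
    finally show ?thesis by simp
  qed
  then have "others_value I i (\<lambda>a. C a + y a) = others_value I i C"
    unfolding others_value_def by (intro sum.cong) auto
  then show ?thesis using y(2) by simp
qed

text \<open>Termination makes the payment claim nonvacuous. In a final state everything is sold, so
  the payment invariant turns into the externality formula.\<close>

theorem theorem13:
  fixes I :: instance_data
  assumes "tiered_instance I"
    and "distinct_valuations I"
    and "not_undersubscribed I"
  shows "(\<exists>S. auction_result I S) \<and>
         (\<forall>S. auction_result I S \<longrightarrow>
            (\<forall>i\<in>{1..num_bidders I}. paid S i = externality I (clinched S) i))"
proof (intro conjI allI impI ballI)
  show "\<exists>S. auction_result I S"
    using auction_terminates[OF assms(1,2) market_invariant_initial[OF assms(1,3)]]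
    unfolding auction_result_def .
next
  fix S i
  assume S: "auction_result I S" and i: "i \<in> {1..num_bidders I}"
  have "payment_invariant I S" if "(auction_step I)\<^sup>*\<^sup>* (initial_state I) S" for S
    using that
    by (induction rule: rtranclp_induct)
      (use payment_invariant_initial[OF assms(1,3)] payment_invariant_step[OF assms(1,2)] in auto)
  then have "residual_optimum I (remaining S) (clinched S) i
      (Max {others_value I i y | y. feasible I y \<and> y i = 0} - paid S i)"
    using S i unfolding auction_result_def payment_invariant_def by blast
  then have "others_value I i (clinched S) =
      Max {others_value I i y | y. feasible I y \<and> y i = 0} - paid S i"
    by (rule residual_optimum_sold_out[OF assms(1)])
      (use S in \<open>auto simp: auction_result_def sold_out_def\<close>)
  then show "paid S i = externality I (clinched S) i"
    unfolding externality_def by linarith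
qed

end
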